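(* Let $X=\mathbb{Z}^{\mathbb{N}}$ and let $G=\mathrm{Hom}(X,\mathbb{Z})$ be the group of all group homomorphisms from $X$ to $\mathbb{Z}$, endowed with the topology of pointwise convergence on $X$. Then every compact subset of $G$ is finite.
   Context: $\mathbb{Z}$ is the group of integers with the discrete topology. $X=\mathbb{Z}^{\mathbb{N}}$ is the Baer-Specker group, i.e. the group of all functions $\mathbb{N}\to\mathbb{Z}$ under pointwise addition. $\mathrm{Hom}(X,\mathbb{Z})$ consists of all (abstract, not assumed continuous) group homomorphisms $X\to\mathbb{Z}$, with pointwise addition. The topology of pointwise convergence on $G$ is the subspace topology inherited from the Tychonoff product $\mathbb{Z}^{X}$. *)

theory Defs
  imports "HOL-Analysis.Function_Topology" "HOL-Algebra.Product_Groups"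
begin

definition baer_specker :: "(nat \<Rightarrow> int) monoid"
  where "baer_specker = product_group UNIV (\<lambda>_::nat. integer_group)"

text \<open>The set \<^const>\<open>hom\<close> does not restrict values off the carrier, but the carrier of
  \<^const>\<open>baer_specker\<close> is the whole type, so each homomorphism occurs exactly once below.\<close>

definition baer_specker_dual :: "((nat \<Rightarrow> int) \<Rightarrow> int) monoid"
  where "baer_specker_dual =
    \<lparr>carrier = hom baer_specker integer_group,
     monoid.mult = (\<lambda>f g x. f x \<otimes>\<^bsub>integer_group\<^esub> g x),
     one = (\<lambda>x. \<one>\<^bsub>integer_group\<^esub>)\<rparr>"

definition pointwise_topology :: "((nat \<Rightarrow> int) \<Rightarrow> int) topology"
  where "pointwise_topology =
    subtopology
      (product_topology (\<lambda>_. discrete_topology (carrier integer_group)) (carrier baer_specker))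
      (carrier baer_specker_dual)"

lemma carrier_baer_specker [simp]: "carrier baer_specker = UNIV"
  by (simp add: baer_specker_def)

lemma mult_baer_specker [simp]: "x \<otimes>\<^bsub>baer_specker\<^esub> y = (\<lambda>n. x n + y n)"
  by (simp add: baer_specker_def restrict_def)

lemma carrier_baer_specker_dual:
  "carrier baer_specker_dual = {f. \<forall>x y. f (\<lambda>n. x n + y n) = f x + f y}"
  by (auto simp: baer_specker_dual_def hom_def)

lemma comm_group_baer_specker: "comm_group baer_specker"
  proof -
  have "group baer_specker"
    by (simp add: baer_specker_def)
  then show ?thesis
    by (rule group.group_comm_groupI) (simp add: add.commute)
qed

lemma comm_group_baer_specker_dual: "comm_group baer_specker_dual"
proof (rule comm_groupI)
  fix f assume f: "f \<in> carrier baer_specker_dual"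
  show "\<exists>g\<in>carrier baer_specker_dual. g \<otimes>\<^bsub>baer_specker_dual\<^esub> f = \<one>\<^bsub>baer_specker_dual\<^esub>"
    using f by (intro bexI[of _ "\<lambda>x. - f x"])
      (simp_all add: carrier_baer_specker_dual, simp add: baer_specker_dual_def)
qed (auto simp: carrier_baer_specker_dual, auto simp: baer_specker_dual_def add_ac)

lemma topspace_pointwise_topology [simp]:
  "topspace pointwise_topology = carrier baer_specker_dual"
  by (auto simp: pointwise_topology_def)

end

theory Submission
  imports Defs "HOL-Library.Function_Algebras"
begin

text \<open>Compactness is used only through the finiteness of each set of values
  \<open>{f x | f \<in> K}\<close>. By Specker, a homomorphism \<open>f\<close> kills almost all unit sequences \<open>e\<^sub>n\<close> and is
  determined by its values on them. If infinitely many \<open>m\<close> were the last index with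
  \<open>f e\<^sub>m \<noteq> 0\<close> for some \<open>f = h\<^sub>m \<in> K\<close>, a gliding hump would produce \<open>x\<close> with
  \<open>\<bar>h\<^sub>m x\<bar> \<ge> m\<close> for all these \<open>m\<close>. Hence some \<open>N\<close> bounds all supports, and \<open>K\<close> embeds
  into a product of \<open>N\<close> finite sets.\<close>

section \<open>Additive maps on sequences and the finiteness of their support\<close>

definition unit_seq :: "nat \<Rightarrow> nat \<Rightarrow> int"
  where "unit_seq i = (\<lambda>k. of_bool (k = i))"

lemma additive_scale:
  fixes f :: "('a \<Rightarrow> int) \<Rightarrow> int"
  assumes "additive f"
  shows "f (\<lambda>k. c * x k) = c * f x"
proof (induction c rule: int_induct[where k = 0])
  case base
  show ?case
    using additive.zero[OF assms] by (simp add: zero_fun_def)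
next
  case (step1 c)
  have "(\<lambda>k. (c + 1) * x k) = (\<lambda>k. c * x k) + x"
    by (auto simp: algebra_simps)
  then show ?case
    using step1 by (simp add: additive.add[OF assms] algebra_simps)
next
  case (step2 c)
  have "(\<lambda>k. c * x k) = (\<lambda>k. (c - 1) * x k) + x"
    by (auto simp: algebra_simps)
  then have "f (\<lambda>k. c * x k) = f (\<lambda>k. (c - 1) * x k) + f x"
    by (simp only: additive.add[OF assms])
  then show ?case
    using step2 by (simp add: algebra_simps)
qed

lemma additive_dvd:
  fixes f :: "('a \<Rightarrow> int) \<Rightarrow> int"
  assumes "additive f" and "\<And>k. d dvd x k"
  shows "d dvd f x"
proof -
  have "x = (\<lambda>k. d * (x k div d))"
    using assms(2) by auto
  then have "f x = d * f (\<lambda>k. x k div d)"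
    by (metis additive_scale[OF assms(1)])
  then show ?thesis
    by simp
qed

text \<open>Additivity peels off only finitely many terms. The rest stays inside \<open>f\<close>,
  where divisibility or vanishing arguments take over.\<close>

lemma additive_split:
  fixes f :: "(nat \<Rightarrow> int) \<Rightarrow> int"
  assumes "additive f"
  shows "f x = (\<Sum>i<n. x i * f (unit_seq i)) + f (\<lambda>k. if k < n then 0 else x k)"
proof (induction n)
  case (Suc n)
  have "(\<lambda>k. if k < n then 0 else x k)
      = (\<lambda>k. x n * unit_seq n k) + (\<lambda>k. if k < Suc n then 0 else x k)"
    by (auto simp: unit_seq_def fun_eq_iff less_Suc_eq)
  then show ?case
    using Suc by (simp add: additive.add[OF assms] additive_scale[OF assms])
qed simp

text \<open>For \<open>x\<close> growing fast along a divisibility chain, \<open>x n\<close> divides the difference of \<open>f x\<close>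
  and its \<open>n\<close>-th partial sum but exceeds its absolute value once \<open>n \<ge> \<bar>f x\<bar>\<close>, so the partial sums
  are eventually constant.\<close>

lemma specker_finite_support:
  fixes f :: "(nat \<Rightarrow> int) \<Rightarrow> int"
  assumes "additive f"
  shows "\<exists>N. \<forall>n\<ge>N. f (unit_seq n) = 0"
proof -
  define S where "S x n = (\<Sum>i<n. x i * f (unit_seq i))" for x n
  have "\<exists>x. \<forall>n. \<bar>S x n\<bar> + int n < x n \<and> (\<forall>i<n. x i dvd x n)"
  proof (rule dependent_wellorder_choice)
    show "(\<bar>S x n\<bar> + int n < r \<and> (\<forall>i<n. x i dvd r)) = (\<bar>S y n\<bar> + int n < r \<and> (\<forall>i<n. y i dvd r))"
      if "\<And>i. i < n \<Longrightarrow> x i = y i" for r x y n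
      using that by (simp add: S_def)
  next
    fix n x
    assume x: "\<And>i. i < n \<Longrightarrow> \<bar>S x i\<bar> + int i < x i \<and> (\<forall>j<i. x j dvd x i)"
    \<comment> \<open>The factor \<open>p\<close> makes every earlier \<open>x i\<close> a divisor;
      \<open>q\<close> provides the size, which survives the multiplication because \<open>p\<close>
      is at least 1.\<close>
    define p q where "p = (\<Prod>i<n. x i)" and "q = \<bar>S x n\<bar> + int n + 1"
    have "0 < p"
      unfolding p_def using x by (intro prod_pos) fastforce
    then have "q * 1 \<le> q * p"
      unfolding q_def by (intro mult_left_mono) auto
    moreover have "\<bar>S x n\<bar> + int n < q"
      by (simp add: q_def)
    ultimately have "\<bar>S x n\<bar> + int n < q * p"
      by linarith
    moreover have "x i dvd q * p" if "i < n" for i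
      unfolding p_def using that by (intro dvd_mult dvd_prodI) auto
    ultimately show "\<exists>r. \<bar>S x n\<bar> + int n < r \<and> (\<forall>i<n. x i dvd r)"
      by blast
  qed
  then obtain x where big: "\<And>n. \<bar>S x n\<bar> + int n < x n" and dvd: "\<And>i n. i < n \<Longrightarrow> x i dvd x n"
    by blast
  have eq: "f x = S x n" if "nat \<bar>f x\<bar> \<le> n" for n
  proof -
    \<comment> \<open>Truncation leaves only entries \<open>x k\<close> with
      \<open>n \<le> k\<close>, and the chain makes \<open>x n\<close> divide each of them.\<close>
    have "x n dvd f (\<lambda>k. if k < n then 0 else x k)"
      using dvd[of n] by (intro additive_dvd[OF assms]) (auto simp: not_less le_less)
    then have "x n dvd f x - S x n"
      using additive_split[OF assms, of x n] by (simp add: S_def)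
    moreover have "\<bar>f x - S x n\<bar> < x n"
      using big[of n] that by linarith
    ultimately show ?thesis
      using zdvd_imp_le[of "x n" "\<bar>f x - S x n\<bar>"] by force
  qed
  have "f (unit_seq n) = 0" if "nat \<bar>f x\<bar> \<le> n" for n
  proof -
    \<comment> \<open>The partial sums at \<open>n\<close> and \<open>Suc n\<close> both equal
      \<open>f x\<close>, and this product is their difference.\<close>
    have "x n * f (unit_seq n) = 0"
      using eq[OF that] eq[of "Suc n"] that by (simp add: S_def)
    then show ?thesis
      using big[of n] by auto
  qed
  then show ?thesis
    by blast
qed

section \<open>Additive maps vanishing on all unit sequences\<close>

lemma eq_0_if_all_powers_dvd:
  fixes a :: int
  assumes "1 < b" and "\<And>n. b ^ n dvd a"
  shows "a = 0"
proof (rule ccontr)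
  assume "a \<noteq> 0"
  then have "b ^ nat \<bar>a\<bar> \<le> \<bar>a\<bar>"
    using assms(2)[of "nat \<bar>a\<bar>"] by (intro zdvd_imp_le) auto
  moreover have "int (nat \<bar>a\<bar>) < 2 ^ nat \<bar>a\<bar>"
    by (rule of_nat_less_two_power)
  moreover have "2 ^ nat \<bar>a\<bar> \<le> b ^ nat \<bar>a\<bar>"
    using assms(1) by (intro power_mono) auto
  ultimately show False
    by linarith
qed

text \<open>The first \<open>n\<close> terms contribute nothing and the remaining entries are
  multiples of \<open>b ^ n\<close>, so every power of \<open>b\<close> divides
  \<open>f x\<close>.\<close>

lemma additive_eq_0_if_powers:
  fixes f :: "(nat \<Rightarrow> int) \<Rightarrow> int"
  assumes "additive f" and unit: "\<And>n. f (unit_seq n) = 0" and "1 < b" and "\<And>n. b ^ n dvd x n"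
  shows "f x = 0"
proof (rule eq_0_if_all_powers_dvd[OF \<open>1 < b\<close>])
  fix n
  have "b ^ n dvd x k" if "n \<le> k" for k
    using dvd_trans[OF le_imp_power_dvd[OF that] assms(4)] .
  then have "b ^ n dvd f (\<lambda>k. if k < n then 0 else x k)"
    by (intro additive_dvd[OF assms(1)]) auto
  then show "b ^ n dvd f x"
    using additive_split[OF assms(1), of x n] by (simp add: unit)
qed

text \<open>Since \<open>2\<^sup>n\<close> and \<open>3\<^sup>n\<close> are coprime, every sequence is the sum of one divisible by \<open>2\<^sup>n\<close>
  and one divisible by \<open>3\<^sup>n\<close> at each place \<open>n\<close>.\<close>

lemma specker_determined:
  fixes f :: "(nat \<Rightarrow> int) \<Rightarrow> int"
  assumes "additive f" and "\<And>n. f (unit_seq n) = 0"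
  shows "f x = 0"
proof -
  have "\<exists>u v. x n = 2 ^ n * u + 3 ^ n * v" for n
  proof -
    have "coprime ((2::int) ^ n) (3 ^ n)"
      by simp
    then obtain u v :: int where "u * 2 ^ n + v * 3 ^ n = 1"
      using bezout_int[of "2 ^ n" "3 ^ n"] by (auto simp: coprime_iff_gcd_eq_1)
    then have "x n = 2 ^ n * (u * x n) + 3 ^ n * (v * x n)"
      by (metis distrib_right mult.assoc mult.commute mult_1)
    then show ?thesis
      by blast
  qed
  then obtain u v where "x = (\<lambda>n. 2 ^ n * u n) + (\<lambda>n. 3 ^ n * v n)"
    unfolding plus_fun_def by metis
  moreover have "f (\<lambda>n. 2 ^ n * u n) = 0" "f (\<lambda>n. 3 ^ n * v n) = 0"
    using additive_eq_0_if_powers[OF assms, of 2] additive_eq_0_if_powers[OF assms, of 3] by auto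
  ultimately show ?thesis
    by (simp add: additive.add[OF assms(1)])
qed

lemma additive_eqI:
  fixes f g :: "(nat \<Rightarrow> int) \<Rightarrow> int"
  assumes "additive f" and "additive g" and "\<And>n. f (unit_seq n) = g (unit_seq n)"
  shows "f = g"
proof
  fix x
  have "additive (\<lambda>x. f x - g x)"
    by (simp add: additive_def additive.add[OF assms(1)] additive.add[OF assms(2)])
  then show "f x = g x"
    using specker_determined[of "\<lambda>x. f x - g x" x] assms(3) by simp
qed

lemma additive_eq_sum:
  fixes f :: "(nat \<Rightarrow> int) \<Rightarrow> int"
  assumes "additive f" and "\<And>n. N \<le> n \<Longrightarrow> f (unit_seq n) = 0"
  shows "f x = (\<Sum>i<N. x i * f (unit_seq i))"
proof -
  let ?t = "\<lambda>y k. if k < N then 0 else (y k :: int)"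
  \<comment> \<open>\<open>f\<close> itself may be nonzero on the first \<open>N\<close> unit
    sequences; precomposing with the truncation kills these, so that
    \<open>specker_determined\<close> applies.\<close>
  have "additive (\<lambda>y. f (?t y))"
  proof
    fix y z :: "nat \<Rightarrow> int"
    have "?t (y + z) = ?t y + ?t z"
      by auto
    then show "f (?t (y + z)) = f (?t y) + f (?t z)"
      by (simp add: additive.add[OF assms(1)])
  qed
  moreover have "f (?t (unit_seq n)) = 0" for n
  proof (cases "n < N")
    case True
    then have "?t (unit_seq n) = 0"
      by (auto simp: unit_seq_def)
    then show ?thesis
      by (simp add: additive.zero[OF assms(1)])
  next
    case False
    then have "?t (unit_seq n) = unit_seq n"
      by (auto simp: unit_seq_def)
    then show ?thesis
      using assms(2) False by simp
  qed
  ultimately have "f (?t x) = 0"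
    by (rule specker_determined)
  then show ?thesis
    using additive_split[OF assms(1), of x N] by simp
qed

section \<open>Pointwise finite families of homomorphisms\<close>

lemma finite_last_support:
  fixes K :: "((nat \<Rightarrow> int) \<Rightarrow> int) set"
  assumes additive: "\<And>f. f \<in> K \<Longrightarrow> additive f" and fin: "\<And>x. finite ((\<lambda>f. f x) ` K)"
  shows "finite {m. \<exists>f\<in>K. f (unit_seq m) \<noteq> 0 \<and> (\<forall>n>m. f (unit_seq n) = 0)}"
proof -
  define A where "A = {m. \<exists>f\<in>K. f (unit_seq m) \<noteq> 0 \<and> (\<forall>n>m. f (unit_seq n) = 0)}"
  have "\<forall>m\<in>A. \<exists>f. f \<in> K \<and> f (unit_seq m) \<noteq> 0 \<and> (\<forall>n>m. f (unit_seq n) = 0)"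
    unfolding A_def by blast
  then obtain h where "\<forall>m\<in>A. h m \<in> K \<and> h m (unit_seq m) \<noteq> 0 \<and> (\<forall>n>m. h m (unit_seq n) = 0)"
    by (rule bchoice[THEN exE])
  then have h: "h m \<in> K" "h m (unit_seq m) \<noteq> 0" "\<And>n. m < n \<Longrightarrow> h m (unit_seq n) = 0"
    if "m \<in> A" for m
    using that by blast+
  \<comment> \<open>\<open>h m\<close> ignores all entries beyond \<open>m\<close>, so once
    \<open>x m\<close> makes its value large, later choices cannot spoil it.\<close>
  obtain x where x: "\<forall>m. m \<in> A \<longrightarrow>
      int m \<le> \<bar>(\<Sum>i<m. x i * h m (unit_seq i)) + x m * h m (unit_seq m)\<bar>"
  proof (atomize_elim, rule dependent_wellorder_choice, goal_cases)
    case (1 r x y m)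
    then show ?case
      by simp
  next
    case (2 m x)
    define s c where "s = (\<Sum>i<m. x i * h m (unit_seq i))" and "c = h m (unit_seq m)"
    have "\<exists>r. int m \<le> \<bar>s + r * c\<bar>" if "c \<noteq> 0"
    proof
      \<comment> \<open>The witness is \<open>\<bar>s\<bar> + int m\<close>: as \<open>c\<close> is
        a nonzero integer, the product outweighs \<open>s\<close> by at least
        \<open>m\<close>.\<close>
      define t where "t = (\<bar>s\<bar> + int m) * c"
      have "(\<bar>s\<bar> + int m) * 1 \<le> (\<bar>s\<bar> + int m) * \<bar>c\<bar>"
        using that by (intro mult_left_mono) auto
      then have "\<bar>s\<bar> + int m \<le> \<bar>t\<bar>"
        by (simp add: t_def abs_mult)
      then show "int m \<le> \<bar>s + (\<bar>s\<bar> + int m) * c\<bar>"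
        unfolding t_def[symmetric] by linarith
    qed
    then show ?case
      using h(2)[of m] unfolding s_def[symmetric] c_def[symmetric] by blast
  qed
  \<comment> \<open>Each \<open>m\<close> in \<open>A\<close> is at most the absolute value of one
    of the finitely many values that \<open>K\<close> takes at \<open>x\<close>.\<close>
  have "A \<subseteq> (\<Union>c\<in>(\<lambda>f. f x) ` K. {m. int m \<le> \<bar>c\<bar>})"
  proof
    fix m
    assume m: "m \<in> A"
    have "h m x = (\<Sum>i<Suc m. x i * h m (unit_seq i))"
      using h[OF m] by (intro additive_eq_sum additive) auto
    then have "int m \<le> \<bar>h m x\<bar>"
      using x m by simp
    then show "m \<in> (\<Union>c\<in>(\<lambda>f. f x) ` K. {m. int m \<le> \<bar>c\<bar>})"
      using h(1)[OF m] by blast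
  qed
  moreover have "finite {m. int m \<le> \<bar>c\<bar>}" for c
    by (rule finite_subset[of _ "{..nat \<bar>c\<bar>}"]) (auto simp: le_nat_iff)
  ultimately have "finite A"
    using fin[of x] by (meson finite_UN_I finite_subset)
  then show ?thesis
    by (simp add: A_def)
qed

lemma finite_if_pointwise_finite:
  fixes K :: "((nat \<Rightarrow> int) \<Rightarrow> int) set"
  assumes additive: "\<And>f. f \<in> K \<Longrightarrow> additive f" and fin: "\<And>x. finite ((\<lambda>f. f x) ` K)"
  shows "finite K"
proof -
  have "finite {m. \<exists>f\<in>K. f (unit_seq m) \<noteq> 0 \<and> (\<forall>n>m. f (unit_seq n) = 0)}"
    using assms by (rule finite_last_support)
  then obtain N where N: "\<And>f m. f \<in> K \<Longrightarrow> f (unit_seq m) \<noteq> 0 \<Longrightarrow>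
      \<forall>n>m. f (unit_seq n) = 0 \<Longrightarrow> m < N"
    by (auto simp: finite_nat_set_iff_bounded)
  have support: "f (unit_seq n) = 0" if f: "f \<in> K" and "N \<le> n" for f n
  proof (rule ccontr)
    assume nz: "f (unit_seq n) \<noteq> 0"
    obtain M where M: "\<And>m. M \<le> m \<Longrightarrow> f (unit_seq m) = 0"
      using specker_finite_support[OF additive[OF f]] by blast
    \<comment> \<open>By the bound \<open>M\<close> this set is finite, so it has a last index, to
      which \<open>N\<close> applies.\<close>
    define B where "B = {m. f (unit_seq m) \<noteq> 0}"
    have B: "finite B" "n \<in> B"
      using M nz by (auto simp: B_def finite_nat_set_iff_bounded not_le[symmetric])
    then have "Max B \<in> B"
      by (metis Max_in empty_iff)
    then have "f (unit_seq (Max B)) \<noteq> 0"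
      unfolding B_def by (rule CollectD)
    moreover have "f (unit_seq m) = 0" if "Max B < m" for m
    proof -
      have "m \<notin> B"
        using Max_ge[OF B(1), of m] that by auto
      then show ?thesis
        by (simp add: B_def)
    qed
    ultimately have "Max B < N"
      by (intro N[OF f] allI impI)
    then show False
      using Max_ge[OF B] \<open>N \<le> n\<close> by simp
  qed
  \<comment> \<open>\<open>restrict\<close> gives all images the same default value from
    \<open>N\<close> on, which places them in a finite extensional product.\<close>
  let ?r = "\<lambda>f. restrict (\<lambda>i. f (unit_seq i)) {..<N}"
  have "inj_on ?r K"
  proof (rule inj_onI)
    fix f g
    assume fg: "f \<in> K" "g \<in> K" "?r f = ?r g"
    have "f (unit_seq n) = g (unit_seq n)" for n
    proof (cases "n < N")
      case True
      then show ?thesis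
        using fun_cong[OF fg(3), of n] by simp
    next
      case False
      then show ?thesis
        using support[OF fg(1), of n] support[OF fg(2), of n] by simp
    qed
    then show "f = g"
      using fg(1,2) additive by (intro additive_eqI)
  qed
  moreover have "?r ` K \<subseteq> (\<Pi>\<^sub>E i\<in>{..<N}. (\<lambda>f. f (unit_seq i)) ` K)"
    by (auto split: if_splits)
  then have "finite (?r ` K)"
    by (rule finite_subset) (simp add: finite_PiE fin)
  ultimately show ?thesis
    by (rule finite_imageD[rotated])
qed

theorem theorem3p1:
  fixes K :: "((nat \<Rightarrow> int) \<Rightarrow> int) set"
  assumes "compactin pointwise_topology K"
  shows "finite K"
proof (rule finite_if_pointwise_finite)
  fix f
  assume "f \<in> K"
  then show "additive f"
    using compactin_subset_topspace[OF assms]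
    by (auto simp: carrier_baer_specker_dual additive_def plus_fun_def)
next
  fix x
  \<comment> \<open>Evaluation at \<open>x\<close> is a coordinate projection of the ambient
    product, and compact subsets of a discrete space are finite.\<close>
  have "continuous_map pointwise_topology (discrete_topology (carrier integer_group)) (\<lambda>f. f x)"
    unfolding pointwise_topology_def
    by (intro continuous_map_from_subtopology continuous_map_product_projection) simp
  from image_compactin[OF assms this] show "finite ((\<lambda>f. f x) ` K)"
    by (simp add: compactin_discrete_topology)
qed

end
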